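(* Let $A=(a_{ij})_{i,j\in I}$ ($I$ a finite set) be a matrix with integer entries of corank $1$, and let $\tau\in\mathrm{Aut}(A)$. Then $\tau|_{\mathrm{Ker}(A)}=\pm\mathrm{id}$. Moreover, a $\tau$-compatible scaling element exists if and only if $\tau|_{\mathrm{Ker}(A)}=\mathrm{id}$.
   Context: $\mathrm{Aut}(A)$ is the group of permutations $\tau$ of $I$ with $a_{\tau(i)\tau(j)}=a_{ij}$ for all $i,j$. It acts on $\mathbb C^I$ by $(\tau(x))_i=x_{\tau^{-1}(i)}$, preserving the one-dimensional space $\mathrm{Ker}(A)=\{x\in\mathbb C^I:\sum_ja_{ij}x_j=0\ \forall i\}$. A minimal realization $(\mathfrak h,\Pi,\Pi^\vee)$ of $A$ (corank $1$) is a complex vector space $\mathfrak h$ of dimension $|I|+1$ with linearly independent families $\Pi=\{\alpha_i\}_{i\in I}\subset\mathfrak h^*$ and $\Pi^\vee=\{h_i\}_{i\in I}\subset\mathfrak h$ such that $\alpha_i(h_j)=a_{ji}$. A framed minimal realization is a minimal realization together with a scaling element $d\in\mathfrak h$ such that $\{h_i\}_{i\in I}\cup\{d\}$ is a basis of $\mathfrak h$ and $\alpha_i(d)\in\mathbb Z$ for all $i\in I$. The scaling element $d$ is $\tau$-compatible if $\alpha_{\tau(i)}(d)=\alpha_i(d)$ for all $i\in I$. "A $\tau$-compatible scaling element exists" means that there is a framed minimal realization of $A$ whose scaling element is $\tau$-compatible. *)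

theory Defs
  imports "HOL-Analysis.Analysis" "HOL-Library.Function_Algebras"
begin

definition complexify :: "int^'i^'i \<Rightarrow> complex^'i^'i" where
  "complexify A = map_matrix of_int A"

definition corank :: "int^'i^'i \<Rightarrow> nat" where
  "corank A = CARD('i) - rank (complexify A)"

definition Ker :: "int^'i^'i \<Rightarrow> (complex^'i) set" where
  "Ker A = {x. complexify A *v x = 0}"

definition Aut :: "int^'i^'i \<Rightarrow> ('i \<Rightarrow> 'i) set" where
  "Aut A = {\<tau>. bij \<tau> \<and> (\<forall>i j. A $ \<tau> i $ \<tau> j = A $ i $ j)}"

definition perm_act :: "('i \<Rightarrow> 'i) \<Rightarrow> complex^'i \<Rightarrow> complex^'i" where
  "perm_act \<tau> x = (\<chi> i. x $ inv \<tau> i)"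

definition lin_indep_family ::
  "(complex \<Rightarrow> 'v::ab_group_add \<Rightarrow> 'v) \<Rightarrow> ('i \<Rightarrow> 'v) \<Rightarrow> bool" where
  "lin_indep_family scl v \<longleftrightarrow> inj v \<and> \<not> module.dependent scl (range v)"

definition fun_scale :: "complex \<Rightarrow> ('h \<Rightarrow> complex) \<Rightarrow> 'h \<Rightarrow> complex" where
  "fun_scale c f = (\<lambda>x. c * f x)"

(* The space \<h> is the whole type 'h with scalar multiplication scl; elements of its dual
   are functions 'h \<Rightarrow> complex that are linear, and linear independence in the dual is linear
   independence in the ambient space of all functions. The dimension is a nonzero natural
   number, so the convention that infinite dimension is 0 is harmless. *)
definition minimal_realization ::
  "(complex \<Rightarrow> 'h::ab_group_add \<Rightarrow> 'h) \<Rightarrow> int^'i^'i \<Rightarrow> ('i \<Rightarrow> 'h \<Rightarrow> complex) \<Rightarrow> ('i \<Rightarrow> 'h) \<Rightarrow> bool"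
  where
  "minimal_realization scl A \<alpha> h \<longleftrightarrow>
     vector_space scl \<and>
     vector_space.dim scl (UNIV :: 'h set) = CARD('i) + 1 \<and>
     (\<forall>i. Vector_Spaces.linear scl (*) (\<alpha> i)) \<and>
     lin_indep_family fun_scale \<alpha> \<and>
     lin_indep_family scl h \<and>
     (\<forall>i j. \<alpha> i (h j) = of_int (A $ j $ i))"

definition framed_minimal_realization ::
  "(complex \<Rightarrow> 'h::ab_group_add \<Rightarrow> 'h) \<Rightarrow> int^'i^'i \<Rightarrow> ('i \<Rightarrow> 'h \<Rightarrow> complex) \<Rightarrow> ('i \<Rightarrow> 'h) \<Rightarrow> 'h \<Rightarrow> bool"
  where
  "framed_minimal_realization scl A \<alpha> h d \<longleftrightarrow>
     minimal_realization scl A \<alpha> h \<and>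
     d \<notin> range h \<and>
     \<not> module.dependent scl (insert d (range h)) \<and>
     module.span scl (insert d (range h)) = UNIV \<and>
     (\<forall>i. \<alpha> i d \<in> \<int>)"

definition compatible :: "('i \<Rightarrow> 'i) \<Rightarrow> ('i \<Rightarrow> 'h \<Rightarrow> complex) \<Rightarrow> 'h \<Rightarrow> bool" where
  "compatible \<tau> \<alpha> d \<longleftrightarrow> (\<forall>i. \<alpha> (\<tau> i) d = \<alpha> i d)"

definition compatible_scaling_element_on ::
  "(complex \<Rightarrow> 'h::ab_group_add \<Rightarrow> 'h) \<Rightarrow> int^'i^'i \<Rightarrow> ('i \<Rightarrow> 'i) \<Rightarrow> bool" where
  "compatible_scaling_element_on scl A \<tau> \<longleftrightarrow>
     (\<exists>\<alpha> h d. framed_minimal_realization scl A \<alpha> h d \<and> compatible \<tau> \<alpha> d)"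

(* HOL cannot quantify existentially over the type carrying the space \<h>. Every complex vector
   space of dimension |I| + 1 is isomorphic to the space of complex vectors indexed by
   'i option, so existence is stated on that space; the theorem additionally
   asserts the necessity of triviality on the kernel for realizations on an arbitrary type. *)
definition compatible_scaling_element_exists :: "int^'i^'i \<Rightarrow> ('i \<Rightarrow> 'i) \<Rightarrow> bool" where
  "compatible_scaling_element_exists A \<tau> \<longleftrightarrow>
     compatible_scaling_element_on ((*s) :: complex \<Rightarrow> complex^('i option) \<Rightarrow> _) A \<tau>"

end

theory Submission
  imports Defs
begin

text \<open>
  Let \<open>k\<close> span the kernel of \<open>A\<close>. The automorphism \<open>\<tau>\<close> acts on this line by a scalar \<open>c\<close>, and
  permuting coordinates preserves \<open>\<Sum>i. k\<^sub>i\<^sup>2\<close>, so \<open>c\<^sup>2 = 1\<close> as soon as that sum is nonzero.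
  It is nonzero because \<open>A\<close> is real: the conjugate of \<open>k\<close> lies on the same line, so
  \<open>\<Sum>i. k\<^sub>i\<^sup>2\<close> is proportional to \<open>\<Sum>i. \<bar>k\<^sub>i\<bar>\<^sup>2 > 0\<close>.

  The scaling element is seen by the kernel through the following observation. A linear
  combination \<open>\<Sum>i. y\<^sub>i \<alpha>\<^sub>i\<close> vanishes on all the \<open>h\<^sub>j\<close> exactly when \<open>y\<close> lies in the kernel, and the
  \<open>h\<^sub>j\<close> together with \<open>d\<close> form a basis. Hence the independence of the \<open>\<alpha>\<^sub>i\<close> means that the
  functional \<open>y \<mapsto> \<Sum>i. y\<^sub>i \<alpha>\<^sub>i(d)\<close> is injective on the kernel. If \<open>d\<close> is \<open>\<tau>\<close>-compatible, this
  functional is \<open>\<tau>\<close>-invariant, so it kills \<open>\<tau>(x) - x\<close> for every \<open>x\<close> in the kernel, and \<open>\<tau>\<close> fixes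
  the kernel pointwise (\<open>compatible_imp_fixes_Ker\<close>). Conversely, if the kernel is fixed, any
  \<open>\<tau>\<close>-invariant integer vector \<open>\<delta>\<close> with \<open>\<Sum>i. k\<^sub>i \<delta>\<^sub>i \<noteq> 0\<close> can be prescribed as the vector of
  values \<open>\<alpha>\<^sub>i(d)\<close> (\<open>framed_minimal_realization_of_values\<close>); the indicator of a level set of \<open>k\<close> at
  a nonzero value is such a vector.
\<close>

section \<open>The kernel and the action of an automorphism on it\<close>

lemma mem_Ker_iff: "x \<in> Ker A \<longleftrightarrow> (\<forall>i. (\<Sum>j\<in>UNIV. of_int (A $ i $ j) * x $ j) = 0)"
  by (simp add: Ker_def complexify_def map_matrix_def matrix_vector_mult_def vec_eq_iff)

lemma Ker_diff: "x \<in> Ker A \<Longrightarrow> y \<in> Ker A \<Longrightarrow> x - y \<in> Ker A"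
  by (simp add: Ker_def matrix_vector_mult_diff_distrib)

lemma Ker_scale: "x \<in> Ker A \<Longrightarrow> c *s x \<in> Ker A"
  by (simp add: Ker_def vec.scale)

lemma Ker_cnj:
  assumes "x \<in> Ker A"
  shows "(\<chi> i. cnj (x $ i)) \<in> Ker A"
proof -
  have "(\<Sum>j\<in>UNIV. of_int (A $ i $ j) * cnj (x $ j)) = cnj (\<Sum>j\<in>UNIV. of_int (A $ i $ j) * x $ j)"
    for i by simp
  with assms show ?thesis
    by (simp add: mem_Ker_iff)
qed

lemma Ker_perm_act:
  assumes "\<tau> \<in> Aut A" "x \<in> Ker A"
  shows "perm_act \<tau> x \<in> Ker A"
  unfolding mem_Ker_iff
proof
  fix i
  have bij: "bij \<tau>" and inv_A: "\<And>i j. A $ \<tau> i $ \<tau> j = A $ i $ j"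
    using assms by (auto simp: Aut_def)
  obtain i' where i: "i = \<tau> i'"
    using bij by (metis bij_pointE)
  have "(\<Sum>j\<in>UNIV. of_int (A $ i $ j) * perm_act \<tau> x $ j)
      = (\<Sum>j\<in>UNIV. of_int (A $ i $ \<tau> j) * perm_act \<tau> x $ \<tau> j)"
    using sum.reindex_bij_betw[OF bij, of "\<lambda>j. of_int (A $ i $ j) * perm_act \<tau> x $ j"] by simp
  also have "\<dots> = (\<Sum>j\<in>UNIV. of_int (A $ i' $ j) * x $ j)"
    by (simp add: i inv_A perm_act_def bij bij_is_inj)
  finally show "(\<Sum>j\<in>UNIV. of_int (A $ i $ j) * perm_act \<tau> x $ j) = 0"
    using assms(2) by (simp add: mem_Ker_iff)
qed

text \<open>
  Some vector \<open>b\<close> completes the rows of \<open>A\<close> to a spanning set. A kernel vector is orthogonal to all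
  rows, so it vanishes if it is orthogonal to \<open>b\<close> as well; thus pairing with \<open>b\<close> embeds the kernel
  into the line of scalars. The bound on the dimension leaves open a zero kernel, for which the
  later claims are trivial; their proofs therefore split on whether a nonzero \<open>k\<close> exists.
\<close>

lemma Ker_at_most_line:
  fixes A :: "int^'i^'i"
  assumes "corank A = 1" "k \<in> Ker A" "k \<noteq> 0" "x \<in> Ker A"
  obtains c where "x = c *s k"
proof -
  let ?R = "rows (complexify A)"
  define dot :: "complex^'i \<Rightarrow> complex^'i \<Rightarrow> complex"
    where "dot b y = (\<Sum>j\<in>UNIV. b $ j * y $ j)" for b y
  have dimR: "vec.dim ?R = CARD('i) - 1"
    using assms(1) by (simp add: corank_def row_rank_def_gen)
  moreover have "CARD('i) > 0" by simp
  ultimately have "vec.dim ?R \<noteq> CARD('i)" by linarith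
  then have "vec.span ?R \<noteq> UNIV"
    by (metis vec.dim_span vec_dim_card)
  then obtain b where b: "b \<notin> vec.span ?R" by blast
  have "vec.dim (insert b ?R) = CARD('i)"
    using b dimR \<open>CARD('i) > 0\<close> by (simp add: vec.dim_insert)
  then have span: "vec.span (insert b ?R) = UNIV"
    by (metis vec.dim_eq_full vec_dim_card vec.dim_UNIV vec.dimension_def)
  have dot_0: "y = 0" if y: "y \<in> Ker A" "dot b y = 0" for y
  proof -
    have "vec.subspace {r. dot r y = 0}"
      unfolding vec.subspace_def dot_def
      by (simp add: ring_distribs sum.distrib mult.assoc flip: sum_distrib_left)
    moreover have "insert b ?R \<subseteq> {r. dot r y = 0}"
      using y by (auto simp: rows_def row_def dot_def mem_Ker_iff complexify_def map_matrix_def)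
    ultimately have all: "dot r y = 0" for r
      using vec.span_minimal[of "insert b ?R" "{r. dot r y = 0}"] span by blast
    have "y $ i = 0" for i
      using all[of "axis i 1"] by (simp add: dot_def axis_def if_distrib[of "\<lambda>a. a * _"] cong: if_cong)
    then show ?thesis by (simp add: vec_eq_iff)
  qed
  have dot_k: "dot b k \<noteq> 0"
    using dot_0 assms by blast
  have "x - (dot b x / dot b k) *s k = 0"
  proof (rule dot_0)
    show "x - (dot b x / dot b k) *s k \<in> Ker A"
      using assms by (intro Ker_diff Ker_scale)
    have "dot b (x - c *s k) = dot b x - c * dot b k" for c
      by (simp add: dot_def algebra_simps sum_subtractf sum_distrib_left)
    with dot_k show "dot b (x - (dot b x / dot b k) *s k) = 0" by simp
  qed
  then show thesis using that by simp
qed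

lemma sum_perm_act:
  fixes g :: "complex \<Rightarrow> 'a::comm_monoid_add"
  assumes "bij \<tau>"
  shows "(\<Sum>i\<in>UNIV. g (perm_act \<tau> x $ i)) = (\<Sum>i\<in>UNIV. g (x $ i))"
  unfolding perm_act_def
  using sum.reindex_bij_betw[OF bij_imp_bij_inv[OF assms], of "\<lambda>i. g (x $ i)"]
  by (simp only: vec_lambda_beta)

lemma perm_act_on_Ker:
  fixes A :: "int^'i^'i"
  assumes "corank A = 1" "\<tau> \<in> Aut A"
  shows "(\<forall>x\<in>Ker A. perm_act \<tau> x = x) \<or> (\<forall>x\<in>Ker A. perm_act \<tau> x = - x)"
proof (cases "\<exists>k\<in>Ker A. k \<noteq> 0")
  case False
  then show ?thesis
    by (auto simp: perm_act_def vec_eq_iff)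
next
  case True
  then obtain k where k: "k \<in> Ker A" "k \<noteq> 0" by blast
  note line = Ker_at_most_line[OF assms(1) k]
  let ?q = "\<Sum>i\<in>UNIV. (k $ i)\<^sup>2"
  obtain c where c: "perm_act \<tau> k = c *s k"
    using line[OF Ker_perm_act[OF assms(2) k(1)]] .
  obtain m where m: "(\<chi> i. cnj (k $ i)) = m *s k"
    using line[OF Ker_cnj[OF k(1)]] .
  \<comment> \<open>Invariance of the sum of squares says nothing about \<open>c\<close> if that sum is zero.\<close>
  have "cnj (k $ i) = m * k $ i" for i
    using m by (simp add: vec_eq_iff)
  then have "m * ?q = (\<Sum>i\<in>UNIV. k $ i * cnj (k $ i))"
    by (simp add: sum_distrib_left power2_eq_square algebra_simps)
  also have "\<dots> = of_real (\<Sum>i\<in>UNIV. (cmod (k $ i))\<^sup>2)"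
    by (simp add: complex_norm_square del: of_real_power)
  also have "\<dots> \<noteq> 0"
    using k(2) by (simp add: sum_nonneg_eq_0_iff vec_eq_iff del: of_real_sum)
  finally have q: "?q \<noteq> 0" by auto
  have "?q = (\<Sum>i\<in>UNIV. (c * k $ i)\<^sup>2)"
    using sum_perm_act[of \<tau> "\<lambda>z. z\<^sup>2" k] assms(2) by (simp add: c Aut_def)
  also have "\<dots> = c\<^sup>2 * ?q"
    by (simp add: power_mult_distrib sum_distrib_left)
  finally have "c\<^sup>2 = 1" using q by simp
  then have "c = 1 \<or> c = -1" by (simp add: power2_eq_1_iff)
  moreover have "perm_act \<tau> x = c *s x" if x: "x \<in> Ker A" for x
  proof -
    obtain e where e: "x = e *s k" using line[OF x] .
    have "perm_act \<tau> x = e *s perm_act \<tau> k"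
      by (simp add: e perm_act_def vec_eq_iff)
    then show ?thesis
      by (simp add: c e mult.commute)
  qed
  ultimately show ?thesis by auto
qed

section \<open>Linear independence of finite families\<close>

lemma lin_indep_family_iff:
  fixes v :: "'i::finite \<Rightarrow> 'v::ab_group_add"
  assumes "vector_space scl"
  shows "lin_indep_family scl v \<longleftrightarrow> (\<forall>c. (\<Sum>i\<in>UNIV. scl (c i) (v i)) = 0 \<longrightarrow> (\<forall>i. c i = 0))"
proof -
  interpret vector_space scl by fact
  have reindex: "(\<Sum>x\<in>range v. scl (u x) x) = (\<Sum>i\<in>UNIV. scl (u (v i)) (v i))" if "inj v" for u
    using that by (simp add: sum.reindex)
  show ?thesis
  proof
    assume *: "lin_indep_family scl v"
    then have inj: "inj v" by (simp add: lin_indep_family_def)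
    show "\<forall>c. (\<Sum>i\<in>UNIV. scl (c i) (v i)) = 0 \<longrightarrow> (\<forall>i. c i = 0)"
    proof (intro allI impI)
      fix c i assume "(\<Sum>i\<in>UNIV. scl (c i) (v i)) = 0"
      then have "(\<Sum>x\<in>range v. scl (c (inv v x)) x) = 0"
        using inj by (simp add: reindex)
      then have "c (inv v (v i)) = 0"
        using * independentD[of "range v" "range v" "\<lambda>x. c (inv v x)" "v i"]
        by (simp add: lin_indep_family_def)
      then show "c i = 0" using inj by simp
    qed
  next
    assume *: "\<forall>c. (\<Sum>i\<in>UNIV. scl (c i) (v i)) = 0 \<longrightarrow> (\<forall>i. c i = 0)"
    have inj: "inj v"
    proof (rule injI, rule ccontr)
      fix i j assume ij: "v i = v j" "i \<noteq> j"
      define c :: "'i \<Rightarrow> complex" where "c l = of_bool (l = i) - of_bool (l = j)" for l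
      have "(\<Sum>l\<in>UNIV. scl (c l) (v l))
          = (\<Sum>l\<in>UNIV. if l = i then v l else 0) - (\<Sum>l\<in>UNIV. if l = j then v l else 0)"
        unfolding sum_subtractf[symmetric]
        by (rule sum.cong) (auto simp: c_def scale_left_diff_distrib)
      also have "\<dots> = 0" using ij by simp
      finally have "c i = 0" using * by blast
      with ij show False by (simp add: c_def)
    qed
    moreover have "independent (range v)"
      using * inj by (auto simp: dependent_finite reindex)
    ultimately show "lin_indep_family scl v"
      by (simp add: lin_indep_family_def)
  qed
qed

lemma sum_fun_apply: "(\<Sum>i\<in>I. f i) x = (\<Sum>i\<in>I. f i x)"
  for f :: "'i \<Rightarrow> 'h \<Rightarrow> complex"
  by (induction I rule: infinite_finite_induct) (auto simp: plus_fun_def zero_fun_def)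

lemma lin_indep_functionals_iff:
  fixes \<alpha> :: "'i::finite \<Rightarrow> 'h \<Rightarrow> complex"
  shows "lin_indep_family fun_scale \<alpha> \<longleftrightarrow>
    (\<forall>c. (\<forall>z. (\<Sum>i\<in>UNIV. c i * \<alpha> i z) = 0) \<longrightarrow> (\<forall>i. c i = 0))"
proof -
  have "vector_space (fun_scale :: complex \<Rightarrow> ('h \<Rightarrow> complex) \<Rightarrow> _)"
    by unfold_locales (auto simp: fun_scale_def fun_eq_iff algebra_simps plus_fun_def)
  from lin_indep_family_iff[OF this, of \<alpha>] show ?thesis
    by (simp add: fun_eq_iff sum_fun_apply zero_fun_def fun_scale_def)
qed

section \<open>Compatible scaling elements\<close>

lemma compatible_imp_fixes_Ker:
  fixes A :: "int^'i^'i"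
  assumes "compatible_scaling_element_on scl A \<tau>" "\<tau> \<in> Aut A" "x \<in> Ker A"
  shows "perm_act \<tau> x = x"
proof -
  obtain \<alpha> h d where fr: "framed_minimal_realization scl A \<alpha> h d" and comp: "compatible \<tau> \<alpha> d"
    using assms(1) by (auto simp: compatible_scaling_element_on_def)
  have mr: "minimal_realization scl A \<alpha> h"
    and span: "module.span scl (insert d (range h)) = UNIV"
    using fr by (auto simp: framed_minimal_realization_def)
  have vs: "vector_space scl"
    and lin: "\<And>i. Vector_Spaces.linear scl (*) (\<alpha> i)"
    and ind: "lin_indep_family fun_scale \<alpha>"
    and \<alpha>h: "\<And>i j. \<alpha> i (h j) = of_int (A $ j $ i)"
    using mr by (auto simp: minimal_realization_def)
  interpret vector_space scl by (fact vs)
  have add: "\<alpha> i (u + w) = \<alpha> i u + \<alpha> i w" and scale: "\<alpha> i (scl c u) = c * \<alpha> i u" for i u w c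
    using lin[of i] by (simp_all add: Vector_Spaces.linear_iff)
  have zero: "\<alpha> i 0 = 0" for i
    using scale[of i 0 0] by simp
  have bij: "bij \<tau>" using assms(2) by (simp add: Aut_def)
  define y where "y = perm_act \<tau> x - x"
  have yK: "y \<in> Ker A"
    unfolding y_def using assms by (intro Ker_diff Ker_perm_act)
  define f where "f z = (\<Sum>i\<in>UNIV. y $ i * \<alpha> i z)" for z
  have "subspace {z. f z = 0}"
    unfolding subspace_def f_def
    by (simp add: add scale zero ring_distribs sum.distrib mult.left_commute flip: sum_distrib_left)
  moreover have "f (h j) = 0" for j
    using yK by (simp add: f_def \<alpha>h mem_Ker_iff mult.commute)
  moreover have "f d = 0"
  proof -
    have "(\<Sum>i\<in>UNIV. perm_act \<tau> x $ i * \<alpha> i d) = (\<Sum>i\<in>UNIV. perm_act \<tau> x $ \<tau> i * \<alpha> (\<tau> i) d)"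
      using sum.reindex_bij_betw[OF bij, of "\<lambda>i. perm_act \<tau> x $ i * \<alpha> i d"] by simp
    also have "\<dots> = (\<Sum>i\<in>UNIV. x $ i * \<alpha> i d)"
      using comp bij by (simp add: compatible_def perm_act_def bij_is_inj)
    finally show ?thesis
      by (simp add: f_def y_def left_diff_distrib sum_subtractf)
  qed
  ultimately have "f z = 0" for z
    using span_minimal[of "insert d (range h)" "{z. f z = 0}"] span by blast
  then have "y $ i = 0" for i
    using ind by (simp add: lin_indep_functionals_iff f_def)
  then show ?thesis
    by (simp add: y_def vec_eq_iff)
qed

text \<open>
  On the coordinate space with basis \<open>h\<^sub>j\<close>, \<open>d\<close> the functionals \<open>\<alpha>\<^sub>i\<close> are determined by \<open>A\<close> and by the
  values \<open>\<delta>\<^sub>i\<close> that they take at \<open>d\<close>. Their independence is the only condition on \<open>\<delta>\<close>, and it is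
  the hypothesis on the kernel below.
\<close>

lemma framed_minimal_realization_of_values:
  fixes A :: "int^'i^'i" and \<delta> :: "'i \<Rightarrow> int"
  assumes "\<And>x. x \<in> Ker A \<Longrightarrow> (\<Sum>i\<in>UNIV. x $ i * of_int (\<delta> i)) = 0 \<Longrightarrow> x = 0"
  shows "\<exists>\<alpha> h d. framed_minimal_realization ((*s) :: complex \<Rightarrow> complex^('i option) \<Rightarrow> _) A \<alpha> h d
    \<and> (\<forall>i. \<alpha> i d = of_int (\<delta> i))"
proof -
  define h :: "'i \<Rightarrow> complex^('i option)" where "h j = axis (Some j) 1" for j
  define d :: "complex^('i option)" where "d = axis None 1"
  define \<alpha> :: "'i \<Rightarrow> complex^('i option) \<Rightarrow> complex"
    where "\<alpha> i z = (\<Sum>j\<in>UNIV. of_int (A $ j $ i) * z $ Some j) + of_int (\<delta> i) * z $ None" for i z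
  have basis: "insert d (range h) = cart_basis"
  proof -
    have "cart_basis = range (\<lambda>j :: 'i option. axis j (1 :: complex))"
      by (auto simp: cart_basis_def)
    also have "\<dots> = insert d (range h)"
      by (simp add: UNIV_option_conv h_def d_def image_image)
    finally show ?thesis ..
  qed
  have \<alpha>h: "\<alpha> i (h j) = of_int (A $ j $ i)" for i j
    by (simp add: \<alpha>_def h_def axis_def if_distrib[of "\<lambda>a. _ * a"] cong: if_cong)
  have \<alpha>d: "\<alpha> i d = of_int (\<delta> i)" for i
    by (simp add: \<alpha>_def d_def axis_def)
  have vs: "vector_space ((*s) :: complex \<Rightarrow> complex^('i option) \<Rightarrow> _)"
    by (fact vec.vector_space_axioms)
  have lin: "Vector_Spaces.linear (*s) (*) (\<alpha> i)" for i
    unfolding Vector_Spaces.linear_iff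
  proof (intro conjI allI)
    show "vector_space ((*) :: complex \<Rightarrow> complex \<Rightarrow> complex)"
      by unfold_locales (auto simp: algebra_simps)
    show "\<alpha> i (u + w) = \<alpha> i u + \<alpha> i w" for u w
      by (simp add: \<alpha>_def ring_distribs sum.distrib)
    show "\<alpha> i (c *s u) = c * \<alpha> i u" for c u
      by (simp add: \<alpha>_def ring_distribs sum_distrib_left mult_ac)
  qed (fact vs)
  have ind_h: "lin_indep_family (*s) h"
    unfolding lin_indep_family_def
  proof
    show "inj h" by (auto simp: inj_def h_def axis_eq_axis)
    show "\<not> vec.dependent (range h)"
      using vec.independent_mono[OF independent_cart_basis] basis by blast
  qed
  have ind_\<alpha>: "lin_indep_family fun_scale \<alpha>"
    unfolding lin_indep_functionals_iff
  proof (intro allI impI)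
    fix c i assume c: "\<forall>z. (\<Sum>i\<in>UNIV. c i * \<alpha> i z) = 0"
    define x :: "complex^'i" where "x = (\<chi> i. c i)"
    have "x \<in> Ker A"
      using c[rule_format, of "h _"] by (simp add: mem_Ker_iff x_def \<alpha>h mult.commute)
    moreover have "(\<Sum>i\<in>UNIV. x $ i * of_int (\<delta> i)) = 0"
      using c[rule_format, of d] by (simp add: x_def \<alpha>d)
    ultimately have "x = 0" by (rule assms)
    then show "c i = 0" by (simp add: x_def vec_eq_iff)
  qed
  have "framed_minimal_realization (*s) A \<alpha> h d"
    unfolding framed_minimal_realization_def minimal_realization_def
  proof (intro conjI allI)
    show "vec.dim (UNIV :: (complex^('i option)) set) = CARD('i) + 1"
      by (simp only: vec_dim_card) simp
    show "d \<notin> range h" by (auto simp: d_def h_def axis_eq_axis)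
    show "\<not> vec.dependent (insert d (range h))"
      by (simp only: basis independent_cart_basis not_False_eq_True)
    show "vec.span (insert d (range h)) = UNIV"
      by (simp only: basis span_cart_basis)
  qed (simp_all add: vs lin ind_h ind_\<alpha> \<alpha>h \<alpha>d)
  with \<alpha>d show ?thesis by blast
qed

lemma fixes_Ker_imp_compatible:
  fixes A :: "int^'i^'i"
  assumes "corank A = 1" "\<tau> \<in> Aut A" and fixed: "\<forall>x\<in>Ker A. perm_act \<tau> x = x"
  shows "compatible_scaling_element_exists A \<tau>"
proof -
  have "\<exists>\<delta> :: 'i \<Rightarrow> int. (\<forall>i. \<delta> (\<tau> i) = \<delta> i) \<and>
      (\<forall>x\<in>Ker A. (\<Sum>i\<in>UNIV. x $ i * of_int (\<delta> i)) = 0 \<longrightarrow> x = 0)"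
  proof (cases "\<exists>k\<in>Ker A. k \<noteq> 0")
    case False
    then show ?thesis by (intro exI[of _ "\<lambda>_. 0"]) auto
  next
    case True
    then obtain k where k: "k \<in> Ker A" "k \<noteq> 0" by blast
    then obtain a where a: "k $ a \<noteq> 0" by (auto simp: vec_eq_iff)
    \<comment> \<open>Level sets of \<open>k\<close> are \<open>\<tau>\<close>-stable, and \<open>k\<close> pairs with this one to its size times \<open>k\<^sub>a\<close>.\<close>
    define \<delta> :: "'i \<Rightarrow> int" where "\<delta> i = of_bool (k $ i = k $ a)" for i
    have "perm_act \<tau> k $ \<tau> i = k $ i" for i
      using assms(2) by (simp add: perm_act_def Aut_def bij_is_inj)
    then have "k $ \<tau> i = k $ i" for i
      using fixed k by simp
    then have inv: "\<delta> (\<tau> i) = \<delta> i" for i by (simp add: \<delta>_def)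
    have "(\<Sum>i\<in>UNIV. k $ i * of_int (\<delta> i)) = (\<Sum>i\<in>UNIV. if k $ i = k $ a then k $ a else 0)"
      by (rule sum.cong) (auto simp: \<delta>_def)
    also have "\<dots> = of_nat (card {i. k $ i = k $ a}) * k $ a"
      by (simp flip: sum.inter_filter)
    finally have pair: "(\<Sum>i\<in>UNIV. k $ i * of_int (\<delta> i)) \<noteq> 0"
      using a by (auto simp: card_eq_0_iff)
    have "x = 0" if x: "x \<in> Ker A" "(\<Sum>i\<in>UNIV. x $ i * of_int (\<delta> i)) = 0" for x
    proof -
      obtain c where c: "x = c *s k"
        using Ker_at_most_line[OF assms(1) k x(1)] .
      then have "c * (\<Sum>i\<in>UNIV. k $ i * of_int (\<delta> i)) = 0"
        using x(2) by (simp add: sum_distrib_left mult.assoc)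
      with pair c show ?thesis by simp
    qed
    with inv show ?thesis by blast
  qed
  then obtain \<delta> :: "'i \<Rightarrow> int" where \<delta>: "\<And>i. \<delta> (\<tau> i) = \<delta> i"
    and nz: "\<And>x. x \<in> Ker A \<Longrightarrow> (\<Sum>i\<in>UNIV. x $ i * of_int (\<delta> i)) = 0 \<Longrightarrow> x = 0"
    by blast
  from framed_minimal_realization_of_values[of A \<delta>, OF nz] \<delta> show ?thesis
    unfolding compatible_scaling_element_exists_def compatible_scaling_element_on_def compatible_def
    by metis
qed

theorem proposition3p1:
  fixes A :: "int^'i^'i" and \<tau> :: "'i \<Rightarrow> 'i"
    and scl :: "complex \<Rightarrow> 'h::ab_group_add \<Rightarrow> 'h"
  assumes "corank A = 1" and "\<tau> \<in> Aut A"
  shows "((\<forall>x\<in>Ker A. perm_act \<tau> x = x) \<or> (\<forall>x\<in>Ker A. perm_act \<tau> x = - x)) \<and>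
    (compatible_scaling_element_exists A \<tau> \<longleftrightarrow> (\<forall>x\<in>Ker A. perm_act \<tau> x = x)) \<and>
    (compatible_scaling_element_on scl A \<tau> \<longrightarrow> (\<forall>x\<in>Ker A. perm_act \<tau> x = x))"
  unfolding compatible_scaling_element_exists_def
proof (intro conjI iffI impI ballI)
  show "(\<forall>x\<in>Ker A. perm_act \<tau> x = x) \<or> (\<forall>x\<in>Ker A. perm_act \<tau> x = - x)"
    using perm_act_on_Ker[OF assms] .
qed (use fixes_Ker_imp_compatible[OF assms] in \<open>simp_all add:
  compatible_imp_fixes_Ker[OF _ assms(2)] compatible_scaling_element_exists_def\<close>)

end
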